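(* Let $G$ be a strongly regular graph on $n$ vertices that is not the pentagon (the $5$-cycle), and let $k$ and $m_i$ ($i=1,\dots,k$) be positive integers with $\sum_{i=1}^k m_i=n$. Then adding the triangle inequalities to $\mathrm{GPP}_{\mathrm m}$ does not improve the bound: the optimal value of $\mathrm{GPP}_{\mathrm m\triangle}$ for the minimum graph partition problem of $G$ equals the optimal value of $\mathrm{GPP}_{\mathrm m}$.
   Context: A simple, undirected, loopless $\kappa$-regular graph on $n$ vertices is strongly regular with parameters $(n,\kappa,\lambda,\mu)$ if it is neither complete nor edgeless and every two distinct vertices have $\lambda$ common neighbors if they are adjacent and $\mu$ common neighbors if they are not (disconnected graphs are allowed). Let $A$ be the adjacency matrix of $G$, $J_n$ the all-ones matrix, $u_n$ the all-ones vector, and $\operatorname{diag}(Y)$ the vector of diagonal entries of $Y$. $\mathrm{GPP}_{\mathrm m}$ is the semidefinite program $$\min\ \tfrac12\operatorname{tr}A(J_n-Y)\quad\text{s.t.}\quad \operatorname{diag}(Y)=u_n,\ \ \operatorname{tr}J_nY=\sum_{i=1}^k m_i^2,\ \ kY-J_n\succeq 0,\ \ Y\ge 0\ \text{(entrywise)},$$ over real symmetric $n\times n$ matrices $Y=(y_{ab})$. $\mathrm{GPP}_{\mathrm m\triangle}$ is the program obtained from $\mathrm{GPP}_{\mathrm m}$ by adding the triangle constraints $$y_{ab}+y_{ac}\le 1+y_{bc}\quad\text{for all triples }(a,b,c)\text{ of distinct vertices}.$$ *)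

theory Defs
  imports "HOL-Analysis.Analysis"
begin

text \<open>A graph is given by its adjacency relation on a finite vertex type \<open>'v\<close>.\<close>

definition simple_graph :: "('v \<Rightarrow> 'v \<Rightarrow> bool) \<Rightarrow> bool" where
  "simple_graph E \<longleftrightarrow> (\<forall>a. \<not> E a a) \<and> (\<forall>a b. E a b \<longrightarrow> E b a)"

definition complete_graph :: "('v \<Rightarrow> 'v \<Rightarrow> bool) \<Rightarrow> bool" where
  "complete_graph E \<longleftrightarrow> (\<forall>a b. a \<noteq> b \<longrightarrow> E a b)"

definition edgeless_graph :: "('v \<Rightarrow> 'v \<Rightarrow> bool) \<Rightarrow> bool" where
  "edgeless_graph E \<longleftrightarrow> (\<forall>a b. \<not> E a b)"

definition regular_graph :: "('v::finite \<Rightarrow> 'v \<Rightarrow> bool) \<Rightarrow> nat \<Rightarrow> bool" where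
  "regular_graph E \<kappa> \<longleftrightarrow> (\<forall>a. card {b. E a b} = \<kappa>)"

definition common_neighbors :: "('v \<Rightarrow> 'v \<Rightarrow> bool) \<Rightarrow> 'v \<Rightarrow> 'v \<Rightarrow> 'v set" where
  "common_neighbors E a b = {c. E a c \<and> E b c}"

definition strongly_regular ::
    "('v::finite \<Rightarrow> 'v \<Rightarrow> bool) \<Rightarrow> nat \<Rightarrow> nat \<Rightarrow> nat \<Rightarrow> nat \<Rightarrow> bool" where
  "strongly_regular E n \<kappa> l \<mu> \<longleftrightarrow>
     simple_graph E \<and> CARD('v) = n \<and> regular_graph E \<kappa> \<and>
     \<not> complete_graph E \<and> \<not> edgeless_graph E \<and>
     (\<forall>a b. a \<noteq> b \<longrightarrow> E a b \<longrightarrow> card (common_neighbors E a b) = l) \<and>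
     (\<forall>a b. a \<noteq> b \<longrightarrow> \<not> E a b \<longrightarrow> card (common_neighbors E a b) = \<mu>)"

text \<open>The graph is isomorphic to the 5-cycle on \<open>{0..<5}\<close>.\<close>

definition is_pentagon :: "('v \<Rightarrow> 'v \<Rightarrow> bool) \<Rightarrow> bool" where
  "is_pentagon E \<longleftrightarrow>
     (\<exists>f :: nat \<Rightarrow> 'v. bij_betw f {0..<5} UNIV \<and>
        (\<forall>i\<in>{0..<5}. \<forall>j\<in>{0..<5}.
           E (f i) (f j) \<longleftrightarrow> j = (i + 1) mod 5 \<or> i = (j + 1) mod 5))"

definition adj_matrix :: "('v::finite \<Rightarrow> 'v \<Rightarrow> bool) \<Rightarrow> real^'v^'v" where
  "adj_matrix E = (\<chi> a b. if E a b then 1 else 0)"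

definition all_ones_matrix :: "real^'v^'v" where
  "all_ones_matrix = (\<chi> a b. 1)"

definition all_ones_vec :: "real^'v" where
  "all_ones_vec = (\<chi> a. 1)"

definition diag_vec :: "real^'v^'v \<Rightarrow> real^'v" where
  "diag_vec Y = (\<chi> a. Y $ a $ a)"

definition symmetric_matrix :: "real^'v^'v \<Rightarrow> bool" where
  "symmetric_matrix Y \<longleftrightarrow> transpose Y = Y"

definition psd :: "real^'v^'v \<Rightarrow> bool" where
  "psd M \<longleftrightarrow> symmetric_matrix M \<and> (\<forall>x. 0 \<le> x \<bullet> (M *v x))"

definition GPPm_objective ::
    "('v::finite \<Rightarrow> 'v \<Rightarrow> bool) \<Rightarrow> real^'v^'v \<Rightarrow> real" where
  "GPPm_objective E Y = 1/2 * trace (adj_matrix E ** (all_ones_matrix - Y))"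

definition GPPm_feasible :: "nat \<Rightarrow> (nat \<Rightarrow> nat) \<Rightarrow> (real^'v::finite^'v) set" where
  "GPPm_feasible k m =
     {Y. symmetric_matrix Y \<and>
         diag_vec Y = all_ones_vec \<and>
         trace (all_ones_matrix ** Y) = (\<Sum>i=1..k. (real (m i))\<^sup>2) \<and>
         psd (real k *\<^sub>R Y - all_ones_matrix) \<and>
         (\<forall>a b. 0 \<le> Y $ a $ b)}"

definition triangle_constraints :: "real^'v^'v \<Rightarrow> bool" where
  "triangle_constraints Y \<longleftrightarrow>
     (\<forall>a b c. a \<noteq> b \<and> a \<noteq> c \<and> b \<noteq> c \<longrightarrow> Y $ a $ b + Y $ a $ c \<le> 1 + Y $ b $ c)"

definition GPPm_triangle_feasible ::
    "nat \<Rightarrow> (nat \<Rightarrow> nat) \<Rightarrow> (real^'v::finite^'v) set" where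
  "GPPm_triangle_feasible k m = {Y \<in> GPPm_feasible k m. triangle_constraints Y}"

text \<open>Optimal values are infima in the extended reals, so that no convention for
  infeasible or unbounded programs is hidden in them.\<close>

definition GPPm_value ::
    "('v::finite \<Rightarrow> 'v \<Rightarrow> bool) \<Rightarrow> nat \<Rightarrow> (nat \<Rightarrow> nat) \<Rightarrow> ereal" where
  "GPPm_value E k m = (INF Y\<in>GPPm_feasible k m. ereal (GPPm_objective E Y))"

definition GPPm_triangle_value ::
    "('v::finite \<Rightarrow> 'v \<Rightarrow> bool) \<Rightarrow> nat \<Rightarrow> (nat \<Rightarrow> nat) \<Rightarrow> ereal" where
  "GPPm_triangle_value E k m =
     (INF Y\<in>GPPm_triangle_feasible k m. ereal (GPPm_objective E Y))"

end

(*
  Y averaged over the edges and over the non-edges of the graph has the form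
  Z = I + y1 A + y2 (J - I - A) and the same objective value. The projections onto the
  eigenspaces of A lie in the span of I, A and J, and averaging preserves the trace of a product
  with any matrix in that span; hence the eigenvalues of kZ - J are nonnegative and Z is feasible.
  With r, s the eigenvalues of A other than the degree, Z satisfies the triangle inequalities as
  soon as s <= -2 and r >= 1. If one of these bounds fails and r, s are integers, then s = -1
  (disjoint cliques) or r = 0 (complete multipartite), and the triples for which the inequality
  could fail do not occur. If r, s are irrational, then the multiplicities, being integers, are
  equal, and the resulting parameters leave only the pentagon.
*)
theory Submission
  imports Defs
begin

section \<open>Traces of symmetric idempotent matrices\<close>

lemma symmetric_idempotent_quadratic_form:
  fixes P :: "real^'v::finite^'v"
  assumes "transpose P = P" "P ** P = P"
  shows "x \<bullet> (P *v x) = (P *v x) \<bullet> (P *v x)"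
proof -
  have "(P *v x) \<bullet> (P *v x) = x \<bullet> (P *v (P *v x))"
    using assms(1) by (metis dot_lmul_matrix vector_transpose_matrix)
  thus ?thesis by (simp add: assms(2) matrix_vector_mul_assoc)
qed

lemma trace_eq_sum_inner_axis:
  fixes M :: "real^'v::finite^'v"
  shows "trace M = (\<Sum>i\<in>UNIV. axis i 1 \<bullet> (M *v axis i 1))"
  by (simp add: trace_def inner_axis' matrix_vector_mul_component inner_axis)

text \<open>Idempotence and cyclicity turn the trace into that of \<open>P ** M ** P\<close>, which
  is a sum of values of the quadratic form of \<open>M\<close> at the columns of
  \<open>P\<close>.\<close>

lemma trace_psd_mult_idempotent_nonneg:
  fixes P M :: "real^'v::finite^'v"
  assumes "transpose P = P" "P ** P = P" "psd M"
  shows "0 \<le> trace (M ** P)"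
proof -
  have "trace (M ** P) = trace ((M ** P) ** P)"
    by (simp add: assms(2) flip: matrix_mul_assoc)
  also have "\<dots> = trace (P ** (M ** P))" by (rule trace_mul_sym)
  also have "\<dots> = (\<Sum>i\<in>UNIV. (P *v axis i 1) \<bullet> (M *v (P *v axis i 1)))"
    unfolding trace_eq_sum_inner_axis
  proof (rule sum.cong[OF refl])
    fix i
    show "axis i 1 \<bullet> (P ** (M ** P) *v axis i 1) = (P *v axis i 1) \<bullet> (M *v (P *v axis i 1))"
      using assms(1) by (metis dot_lmul_matrix vector_transpose_matrix matrix_vector_mul_assoc)
  qed
  also have "\<dots> \<ge> 0" using assms(3) by (intro sum_nonneg) (auto simp: psd_def)
  finally show ?thesis .
qed

lemma trace_symmetric_idempotent_pos:
  fixes P :: "real^'v::finite^'v"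
  assumes "transpose P = P" "P ** P = P" "P \<noteq> 0"
  shows "0 < trace P"
proof -
  obtain a b where ab: "P $ a $ b \<noteq> 0" using assms(3) by (auto simp: vec_eq_iff)
  have "P *v axis b 1 \<noteq> 0"
    using ab by (auto simp: vec_eq_iff matrix_vector_mul_component inner_axis)
  then show ?thesis
    unfolding trace_eq_sum_inner_axis symmetric_idempotent_quadratic_form[OF assms(1,2)]
    by (intro sum_pos2[of _ b]) auto
qed

text \<open>The trace is the rank. For an orthonormal basis \<open>B\<close> of the range, the
  quadratic form of \<open>P\<close> is the sum of the squared coordinates along \<open>B\<close>;
  summed over the standard basis this gives the sum of the squared norms of \<open>B\<close>, that
  is, \<open>card B\<close>. It makes the eigenvalue multiplicities integers.\<close>

lemma trace_symmetric_idempotent_Nats: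
  fixes P :: "real^'v::finite^'v"
  assumes "transpose P = P" "P ** P = P"
  shows "trace P \<in> \<nat>"
proof -
  have "subspace (range ((*v) P))" by (simp add: linear_subspace_image)
  then obtain B where B: "B \<subseteq> range ((*v) P)" "pairwise orthogonal B"
      "\<And>x. x \<in> B \<Longrightarrow> norm x = 1" "independent B" "card B = dim (range ((*v) P))"
      "span B = range ((*v) P)"
    by (rule orthonormal_basis_subspace) blast
  have fin: "finite B" using B(4) by (rule independent_imp_finite)
  have adj: "(P *v x) \<bullet> y = x \<bullet> (P *v y)" for x y
    using assms(1) by (metis dot_lmul_matrix vector_transpose_matrix)
  have fix_B: "P *v u = u" if "u \<in> B" for u
    using that B(1) assms(2) by (auto simp: matrix_vector_mul_assoc)
  have "x \<bullet> (P *v x) = (\<Sum>u\<in>B. (x \<bullet> u)\<^sup>2)" for x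
  proof -
    have "P *v x \<in> span B" using B(6) by simp
    with B(2,3) have "(\<Sum>u\<in>B. ((P *v x) \<bullet> u) *\<^sub>R u) = P *v x"
      using fin by (rule orthonormal_basis_expand)
    then have "x \<bullet> (P *v x) = (\<Sum>u\<in>B. ((P *v x) \<bullet> u) * (x \<bullet> u))"
      by (metis (no_types, lifting) inner_scaleR_right inner_sum_right sum.cong)
    also have "\<dots> = (\<Sum>u\<in>B. (x \<bullet> u)\<^sup>2)"
      by (intro sum.cong) (simp_all add: adj fix_B power2_eq_square)
    finally show ?thesis .
  qed
  then have "trace P = (\<Sum>i\<in>UNIV. \<Sum>u\<in>B. (u $ i)\<^sup>2)"
    by (simp add: trace_eq_sum_inner_axis inner_axis')
  also have "\<dots> = (\<Sum>u\<in>B. \<Sum>i\<in>UNIV. (u $ i)\<^sup>2)" by (rule sum.swap)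
  also have "\<dots> = (\<Sum>u\<in>B. (norm u)\<^sup>2)"
    unfolding power2_norm_eq_inner inner_vec_def by (simp add: power2_eq_square)
  also have "\<dots> = real (card B)" using B(3) by simp
  finally show ?thesis by simp
qed

section \<open>The algebra spanned by I, A and J\<close>

text \<open>This is x I + y A + z J. Diagonal entries are x + z, edge entries y + z and the
  remaining ones z, so a matrix with values 1, y1, y2 in these places has coefficients
  \<open>1 - y2\<close>, \<open>y1 - y2\<close>, \<open>y2\<close>.\<close>

definition bose_mesner :: "('v::finite \<Rightarrow> 'v \<Rightarrow> bool) \<Rightarrow> real \<Rightarrow> real \<Rightarrow> real \<Rightarrow> real^'v^'v" where
  "bose_mesner E x y z = (\<chi> a b. x * of_bool (a = b) + y * of_bool (E a b) + z)"

lemma bose_mesner_nth [simp]: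
  "bose_mesner E x y z $ a $ b = x * of_bool (a = b) + y * of_bool (E a b) + z"
  by (simp add: bose_mesner_def)

locale srg =
  fixes E :: "'v::finite \<Rightarrow> 'v \<Rightarrow> bool" and n \<kappa> l \<mu> :: nat
  assumes srg: "strongly_regular E n \<kappa> l \<mu>"
begin

lemma irrefl [simp]: "\<not> E a a" and sym: "E a b \<longleftrightarrow> E b a"
  and card_UNIV: "CARD('v) = n"
  and card_nbrs: "card {b. E a b} = \<kappa>"
  and card_common_adj: "E a b \<Longrightarrow> card (common_neighbors E a b) = l"
  and card_common_nonadj: "a \<noteq> b \<Longrightarrow> \<not> E a b \<Longrightarrow> card (common_neighbors E a b) = \<mu>"
  using srg by (simp_all add: strongly_regular_def simple_graph_def regular_graph_def) metis+

lemma sum_adj: "(\<Sum>c\<in>UNIV. of_bool (E a c)) = real \<kappa>"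
  by (simp add: of_bool_def sum.If_cases card_nbrs)

lemma sum_adj': "(\<Sum>c\<in>UNIV. of_bool (E c a)) = real \<kappa>"
  using sum_adj[of a] by (simp add: sym)

text \<open>The entries of the square of A count common neighbors, on the diagonal the degree. The
  identity expresses this square in I, A and J.\<close>

lemma sum_adj_adj:
  "(\<Sum>c\<in>UNIV. of_bool (E a c) * of_bool (E c b)) =
     (real \<kappa> - real \<mu>) * of_bool (a = b) + (real l - real \<mu>) * of_bool (E a b) + real \<mu>"
proof -
  have "(\<Sum>c\<in>UNIV. of_bool (E a c) * of_bool (E c b)) = real (card (common_neighbors E a b))"
    by (simp add: common_neighbors_def sym[of _ b] flip: of_bool_conj)
  also have "\<dots> = (real \<kappa> - real \<mu>) * of_bool (a = b) + (real l - real \<mu>) * of_bool (E a b) + real \<mu>"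
    using card_common_adj[of a b] card_common_nonadj[of a b] card_nbrs[of a]
    by (cases "a = b") (auto simp: common_neighbors_def)
  finally show ?thesis .
qed

text \<open>The span is closed under products because A squared lies in it, AJ = JA = \<kappa> J and
  JJ = nJ.\<close>

lemma bose_mesner_mult:
  "bose_mesner E x y z ** bose_mesner E x' y' z' =
     bose_mesner E (x * x' + y * y' * (real \<kappa> - real \<mu>))
       (x * y' + y * x' + y * y' * (real l - real \<mu>))
       (x * z' + z * x' + real \<kappa> * (y * z' + z * y') + real n * z * z' + y * y' * real \<mu>)"
  (is "?L = ?R")
proof -
  have "?L $ a $ b = ?R $ a $ b" for a b
  proof -
    have delta: "(\<Sum>c\<in>UNIV. of_bool (a = c) * g c) = g a"
        "(\<Sum>c\<in>UNIV. g c * of_bool (c = b)) = g b" for g :: "'v \<Rightarrow> real"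
      by (simp_all add: of_bool_def if_distrib[of "\<lambda>x. _ * x"] if_distrib[of "\<lambda>x. x * _"] cong: if_cong)
    have "?L $ a $ b = (\<Sum>c\<in>UNIV. x * x' * (of_bool (a = c) * of_bool (c = b))
        + x * y' * (of_bool (a = c) * of_bool (E c b)) + x * z' * (of_bool (a = c) * 1)
        + y * x' * (of_bool (E a c) * of_bool (c = b))
        + y * y' * (of_bool (E a c) * of_bool (E c b)) + y * z' * of_bool (E a c)
        + z * x' * (1 * of_bool (c = b)) + z * y' * of_bool (E c b) + z * z')"
      by (simp add: matrix_matrix_mult_def algebra_simps)
    also have "\<dots> = ?R $ a $ b"
      unfolding sum.distrib sum_distrib_left[symmetric] delta sum_adj sum_adj' sum_adj_adj
      by (simp add: card_UNIV algebra_simps)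
    finally show ?thesis .
  qed
  then show ?thesis by (simp add: vec_eq_iff)
qed

lemma transpose_bose_mesner: "transpose (bose_mesner E x y z) = bose_mesner E x y z"
  by (auto simp: vec_eq_iff transpose_def sym)

lemma trace_bose_mesner: "trace (bose_mesner E x y z) = real n * (x + z)"
  by (simp add: trace_def card_UNIV)


section \<open>Relations between the parameters\<close>

lemma ex_adj: "\<exists>a b. E a b"
  and ex_nonadj: "\<exists>a b. a \<noteq> b \<and> \<not> E a b"
  using srg by (auto simp: strongly_regular_def complete_graph_def edgeless_graph_def)

lemma degree_pos: "\<kappa> > 0"
proof -
  obtain a b where "E a b" using ex_adj by blast
  then have "{b. E a b} \<noteq> {}" by blast
  then show ?thesis using card_nbrs[of a] by (metis card_gt_0_iff finite)
qed

lemma degree_less: "\<kappa> + 1 < n"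
proof -
  obtain a b where "a \<noteq> b" "\<not> E a b" using ex_nonadj by blast
  then have "card ({c. E a c} \<union> {a, b}) = \<kappa> + 2"
    by (subst card_Un_disjoint) (auto simp: card_nbrs)
  moreover have "card ({c. E a c} \<union> {a, b}) \<le> n"
    unfolding card_UNIV[symmetric] by (rule card_mono) auto
  ultimately show ?thesis by simp
qed

lemma common_adj_less: "l < \<kappa>"
proof -
  obtain a b where ab: "E a b" using ex_adj by blast
  have "common_neighbors E a b \<subset> {c. E a c}"
  proof
    show "common_neighbors E a b \<subseteq> {c. E a c}" by (auto simp: common_neighbors_def)
    have "b \<in> {c. E a c}" "b \<notin> common_neighbors E a b" using ab by (simp_all add: common_neighbors_def)
    then show "common_neighbors E a b \<noteq> {c. E a c}" by blast
  qed
  then show ?thesis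
    using psubset_card_mono[of "{c. E a c}" "common_neighbors E a b"]
    by (simp add: card_common_adj[OF ab] card_nbrs)
qed

lemma common_nonadj_le: "\<mu> \<le> \<kappa>"
proof -
  obtain a b where ab: "a \<noteq> b" "\<not> E a b" using ex_nonadj by blast
  have "common_neighbors E a b \<subseteq> {c. E a c}" by (auto simp: common_neighbors_def)
  then show ?thesis
    using card_mono[of "{c. E a c}" "common_neighbors E a b"]
    by (simp add: card_common_nonadj[OF ab] card_nbrs)
qed

text \<open>Double counting of the walks of length two that start at a fixed vertex.\<close>

lemma degree_equation:
  "real \<kappa> * real \<kappa> = (real \<kappa> - real \<mu>) + (real l - real \<mu>) * real \<kappa> + real \<mu> * real n"
proof -
  fix a :: 'v
  have "(\<Sum>b\<in>UNIV. \<Sum>c\<in>UNIV. of_bool (E a c) * of_bool (E c b)) =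
      (\<Sum>c\<in>UNIV. \<Sum>b\<in>UNIV. of_bool (E a c) * (of_bool (E c b) :: real))"
    by (rule sum.swap)
  also have "\<dots> = real \<kappa> * real \<kappa>"
    by (simp add: sum_adj flip: sum_distrib_left sum_distrib_right)
  finally have "real \<kappa> * real \<kappa> = (\<Sum>b\<in>UNIV. \<Sum>c\<in>UNIV. of_bool (E a c) * of_bool (E c b))" ..
  also have "\<dots> = (real \<kappa> - real \<mu>) + (real l - real \<mu>) * real \<kappa> + real n * real \<mu>"
    unfolding sum_adj_adj sum.distrib sum_distrib_left[symmetric] sum_adj
    by (simp add: card_UNIV of_bool_def)
  finally show ?thesis by (simp only: mult.commute[of "real n"])
qed

text \<open>With \<kappa> = l + 1 the common neighbors of \<open>a\<close> and \<open>b\<close> are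
  all neighbors of \<open>a\<close> except \<open>b\<close>, and \<open>c\<close> is one of these.
  The graph is a disjoint union of cliques.\<close>

lemma adj_twins:
  assumes "\<kappa> = l + 1" "E a b" "E a c" "b \<noteq> c"
  shows "E b c"
proof -
  have "common_neighbors E a b = {c. E a c} - {b}"
    using assms card_common_adj[of a b] card_nbrs[of a]
    by (intro card_subset_eq) (auto simp: common_neighbors_def)
  then show ?thesis using assms by (auto simp: common_neighbors_def)
qed

text \<open>With \<kappa> = \<mu> two nonadjacent vertices have the same neighbors. The graph is
  complete multipartite.\<close>

lemma nonadj_twins:
  assumes "\<kappa> = \<mu>" "a \<noteq> b" "\<not> E a b" "\<not> E a c"
  shows "\<not> E b c"
proof -
  have "common_neighbors E a b = {c. E b c}"
    using assms card_common_nonadj[of a b] card_nbrs[of b]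
    by (intro card_subset_eq) (auto simp: common_neighbors_def)
  then show ?thesis using assms by (auto simp: common_neighbors_def)
qed

section \<open>Eigenvalues and eigenprojections of the adjacency matrix\<close>

text \<open>\<open>r\<close> and \<open>s\<close> are the roots of x^2 - (l - \<mu>) x - (\<kappa> -
  \<mu>), to which A reduces on the complement of the all-ones vector.\<close>

definition r :: real where
  "r = ((real l - real \<mu>) + sqrt ((real l - real \<mu>)\<^sup>2 + 4 * (real \<kappa> - real \<mu>))) / 2"

definition s :: real where
  "s = ((real l - real \<mu>) - sqrt ((real l - real \<mu>)\<^sup>2 + 4 * (real \<kappa> - real \<mu>))) / 2"

lemma r_plus_s: "r + s = real l - real \<mu>"
  by (simp add: r_def s_def field_simps)

lemma r_times_s: "r * s = real \<mu> - real \<kappa>"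
proof -
  define e q where "e = real l - real \<mu>" and "q = sqrt (e\<^sup>2 + 4 * (real \<kappa> - real \<mu>))"
  have "q\<^sup>2 = e\<^sup>2 + 4 * (real \<kappa> - real \<mu>)"
    unfolding q_def using common_nonadj_le by (intro real_sqrt_pow2) simp
  moreover have rs: "r = (e + q) / 2" "s = (e - q) / 2"
    unfolding r_def s_def e_def q_def by simp_all
  have "r * s = (e\<^sup>2 - q\<^sup>2) / 4"
    unfolding rs by (simp add: power2_eq_square algebra_simps)
  ultimately show ?thesis by simp
qed

text \<open>The discriminant is positive even for \<kappa> = \<mu>, since then l < \<mu>.\<close>

lemma s_less_r: "s < r"
proof -
  have "(real l - real \<mu>)\<^sup>2 + 4 * (real \<kappa> - real \<mu>) > 0"
  proof (cases "\<kappa> = \<mu>")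
    case True
    then show ?thesis using common_adj_less by simp
  next
    case False
    then have "real \<kappa> - real \<mu> > 0" using common_nonadj_le by simp
    then show ?thesis by (intro add_nonneg_pos) simp_all
  qed
  then show ?thesis by (simp add: r_def s_def)
qed

lemma r_nonneg: "0 \<le> r"
proof (rule ccontr)
  assume "\<not> 0 \<le> r"
  then have "0 < r * s" using s_less_r by (intro mult_neg_neg) auto
  then show False using r_times_s common_nonadj_le by simp
qed

lemma r_pos: "\<kappa> \<noteq> \<mu> \<Longrightarrow> 0 < r"
  using r_nonneg r_times_s by (cases "r = 0") auto

text \<open>The sign of this polynomial at -2, -1 and 1 decides on which side of these numbers the
  eigenvalues lie. At -1 its value is l + 1 - \<kappa>.\<close>

lemma eigenvalues_shift: "(x - r) * (x - s) = x * x - (real l - real \<mu>) * x - (real \<kappa> - real \<mu>)"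
proof -
  have "(x - r) * (x - s) = x * x - (r + s) * x + r * s" by (simp add: algebra_simps)
  then show ?thesis by (simp add: r_plus_s r_times_s)
qed

lemma s_le: "s \<le> - 1"
proof (rule ccontr)
  assume "\<not> s \<le> - 1"
  then have "0 < (- 1 - r) * (- 1 - s)" using r_nonneg by (intro mult_neg_neg) auto
  then show False using common_adj_less by (simp add: eigenvalues_shift)
qed

lemma s_less: "\<kappa> \<noteq> l + 1 \<Longrightarrow> s < - 1"
  using s_le eigenvalues_shift[of "- 1"] by (cases "s = - 1") auto

text \<open>The orthogonal projection onto the \<open>\<theta>\<close>-eigenspace of the adjacency matrix inside the
  complement of the all-ones vector, where \<open>\<tau>\<close> is the other eigenvalue.\<close>

definition proj :: "real \<Rightarrow> real \<Rightarrow> real^'v^'v" where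
  "proj \<theta> \<tau> = bose_mesner E (- \<tau> / (\<theta> - \<tau>)) (1 / (\<theta> - \<tau>)) (- ((real \<kappa> - \<tau>) / real n) / (\<theta> - \<tau>))"

text \<open>The J-coefficient of \<open>proj\<close> is chosen so that \<open>proj\<close>
  annihilates the all-ones vector, which is why \<open>z\<close> disappears from the
  eigenvalue.\<close>

lemma bose_mesner_mult_proj:
  assumes "\<theta> \<noteq> \<tau>" "\<theta> + \<tau> = real l - real \<mu>" "\<theta> * \<tau> = real \<mu> - real \<kappa>"
  shows "bose_mesner E x y z ** proj \<theta> \<tau> = (x + y * \<theta>) *\<^sub>R proj \<theta> \<tau>"
proof -
  define d where "d = \<theta> - \<tau>"
  define c where "c = (real \<kappa> - \<tau>) / real n"
  have n: "real n > 0" using degree_less by simp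
  have d: "d \<noteq> 0" using assms by (simp add: d_def)
  have nc: "real n * c = real \<kappa> - \<tau>" using n by (simp add: c_def)
  \<comment> \<open>The degree equation in factored form: (\<kappa> - \<theta>)(\<kappa> - \<tau>) =
    n \<mu>.\<close>
  have "real n * (c * (real \<kappa> - \<theta>)) = (real \<kappa> - \<tau>) * (real \<kappa> - \<theta>)"
    by (simp flip: nc)
  also have "\<dots> = real \<kappa> * real \<kappa> - (\<theta> + \<tau>) * real \<kappa> + \<theta> * \<tau>" by (simp add: algebra_simps)
  also have "\<dots> = real n * real \<mu>" unfolding assms using degree_equation by (simp add: algebra_simps)
  finally have mu: "real \<mu> = c * (real \<kappa> - \<theta>)" using n by simp
  have km: "real \<kappa> - real \<mu> = - \<theta> * \<tau>" using assms by simp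
  have 1: "x * (- \<tau> / d) + y * (1 / d) * (real \<kappa> - real \<mu>) = (x + y * \<theta>) * (- \<tau> / d)"
    using d unfolding km by (simp add: field_simps)
  have 2: "x * (1 / d) + y * (- \<tau> / d) + y * (1 / d) * (real l - real \<mu>) = (x + y * \<theta>) * (1 / d)"
    using d unfolding assms(2)[symmetric] by (simp add: field_simps)
  have "x * (- c / d) + z * (- \<tau> / d) + real \<kappa> * (y * (- c / d) + z * (1 / d))
      + real n * z * (- c / d) + y * (1 / d) * real \<mu>
      = (x * (- c) + z * (- \<tau>) + real \<kappa> * (y * (- c) + z) + z * (- (real n * c)) + y * real \<mu>) / d"
    by (simp add: divide_inverse algebra_simps)
  also have "\<dots> = (x + y * \<theta>) * (- c) / d"
    unfolding mu nc by (simp add: algebra_simps)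
  finally have 3: "x * (- c / d) + z * (- \<tau> / d) + real \<kappa> * (y * (- c / d) + z * (1 / d))
      + real n * z * (- c / d) + y * (1 / d) * real \<mu> = (x + y * \<theta>) * (- c / d)"
    by simp
  show ?thesis
    unfolding proj_def bose_mesner_mult d_def[symmetric] c_def[symmetric] 1 2 3
    by (simp add: vec_eq_iff algebra_simps)
qed

lemma proj_idempotent:
  assumes "\<theta> \<noteq> \<tau>" "\<theta> + \<tau> = real l - real \<mu>" "\<theta> * \<tau> = real \<mu> - real \<kappa>"
  shows "proj \<theta> \<tau> ** proj \<theta> \<tau> = proj \<theta> \<tau>"
proof -
  have "(\<theta> - \<tau>) / (\<theta> - \<tau>) = 1" using assms(1) by simp
  then have "- \<tau> / (\<theta> - \<tau>) + 1 / (\<theta> - \<tau>) * \<theta> = 1" unfolding diff_divide_distrib by simp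
  then show ?thesis
    using bose_mesner_mult_proj[OF assms] by (metis proj_def scaleR_one)
qed

lemma transpose_proj: "transpose (proj \<theta> \<tau>) = proj \<theta> \<tau>"
  by (simp add: proj_def transpose_bose_mesner)

lemma proj_nonzero:
  assumes "\<theta> \<noteq> \<tau>"
  shows "proj \<theta> \<tau> \<noteq> 0"
proof
  assume *: "proj \<theta> \<tau> = 0"
  obtain a b where ab: "E a b" using ex_adj by blast
  obtain c d where cd: "c \<noteq> d" "\<not> E c d" using ex_nonadj by blast
  have "a \<noteq> b" using ab by auto
  have "proj \<theta> \<tau> $ a $ b - proj \<theta> \<tau> $ c $ d = 1 / (\<theta> - \<tau>)"
    using ab cd \<open>a \<noteq> b\<close> by (simp add: proj_def)
  then show False using assms by (simp add: *)
qed

lemma eigenvalues_r: "r \<noteq> s" "r + s = real l - real \<mu>" "r * s = real \<mu> - real \<kappa>"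
  and eigenvalues_s: "s \<noteq> r" "s + r = real l - real \<mu>" "s * r = real \<mu> - real \<kappa>"
  using s_less_r r_plus_s r_times_s by (auto simp: algebra_simps)

text \<open>\<open>M\<close> need not lie in the algebra: equality of the traces against the
  projection suffices to make an eigenvalue of its counterpart in the algebra nonnegative. This is
  how semidefiniteness passes from a matrix to its average.\<close>

lemma psd_trace_proj_imp_nonneg:
  assumes "psd M" "\<theta> \<noteq> \<tau>" "\<theta> + \<tau> = real l - real \<mu>" "\<theta> * \<tau> = real \<mu> - real \<kappa>"
    and "trace (M ** proj \<theta> \<tau>) = trace (bose_mesner E x y z ** proj \<theta> \<tau>)"
  shows "0 \<le> x + y * \<theta>"
proof -
  note idem = transpose_proj proj_idempotent[OF assms(2-4)]
  have "0 \<le> (x + y * \<theta>) * trace (proj \<theta> \<tau>)"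
    using trace_psd_mult_idempotent_nonneg[OF idem assms(1)] assms(5)
    by (simp add: bose_mesner_mult_proj[OF assms(2-4)] trace_def sum_distrib_left)
  moreover have "trace (proj \<theta> \<tau>) > 0"
    using trace_symmetric_idempotent_pos[OF idem proj_nonzero] assms(2) by blast
  ultimately show ?thesis by (simp add: zero_le_mult_iff)
qed

text \<open>The matrix is a combination of the projections onto the two eigenspaces and onto the
  all-ones vector, and the three hypotheses are the signs of the coefficients.\<close>

lemma psd_bose_mesner:
  assumes "0 \<le> x + y * r" "0 \<le> x + y * s" "0 \<le> x + y * real \<kappa> + z * real n"
  shows "psd (bose_mesner E x y z)"
proof -
  let ?J = "bose_mesner E 0 0 (1 / real n)"
  have n: "real n > 0" using degree_less by simp
  define d where "d = r - s"
  have d: "d \<noteq> 0" "s - r = - d" using s_less_r by (simp_all add: d_def)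
  have r: "r = s + d" by (simp add: d_def)
  have decomp: "bose_mesner E x y z = (x + y * r) *\<^sub>R proj r s + (x + y * s) *\<^sub>R proj s r
      + (x + y * real \<kappa> + z * real n) *\<^sub>R ?J"
  proof -
    have c1: "(x + y * (s + d)) * (- s / d) + (x + y * s) * (- (s + d) / (- d)) = x"
      and c2: "(x + y * (s + d)) * (1 / d) + (x + y * s) * (1 / (- d)) = y"
      using d(1) by (simp_all add: field_simps)
    have "(x + y * (s + d)) * (- ((real \<kappa> - s) / real n) / d)
        + (x + y * s) * (- ((real \<kappa> - (s + d)) / real n) / (- d)) =
        ((x + y * (s + d)) * (- (real \<kappa> - s)) / d
          + (x + y * s) * (- (real \<kappa> - (s + d))) / (- d)) / real n"
      by (simp add: divide_inverse algebra_simps)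
    also have "(x + y * (s + d)) * (- (real \<kappa> - s)) / d
          + (x + y * s) * (- (real \<kappa> - (s + d))) / (- d) = - x - y * real \<kappa>"
      using d(1) by (simp add: field_simps)
    also have "\<dots> / real n = z - (x + y * real \<kappa> + z * real n) * (1 / real n)"
      using n by (simp add: field_simps)
    finally have c3: "(x + y * (s + d)) * (- ((real \<kappa> - s) / real n) / d)
        + (x + y * s) * (- ((real \<kappa> - (s + d)) / real n) / (- d))
        + (x + y * real \<kappa> + z * real n) * (1 / real n) = z"
      by linarith
    \<comment> \<open>Here \<open>t\<close> and \<open>u\<close> stand for the 0-1 entries of I and
      A, so the matrix identity reduces to the three coefficient identities \<open>c1\<close>,
      \<open>c2\<close>, \<open>c3\<close>.\<close>
    have combine: "p1 * (q1 * t + w1 * u + v1) + p2 * (q2 * t + w2 * u + v2) + p3 * (0 * t + 0 * u + v3)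
        = x * t + y * u + z"
      if "p1 * q1 + p2 * q2 = x" "p1 * w1 + p2 * w2 = y" "p1 * v1 + p2 * v2 + p3 * v3 = z"
      for p1 p2 p3 q1 q2 w1 w2 v1 v2 v3 t u :: real
      unfolding that[symmetric] by (simp add: algebra_simps)
    show ?thesis
      unfolding proj_def d d_def[symmetric] unfolding r
      by (simp only: vec_eq_iff vector_add_component vector_scaleR_component bose_mesner_nth
          real_scaleR_def combine[OF c1 c2 c3] simp_thms)
  qed
  have "?J ** ?J = ?J" using n by (simp add: bose_mesner_mult)
  note J = symmetric_idempotent_quadratic_form[OF transpose_bose_mesner this]
  note P = symmetric_idempotent_quadratic_form[OF transpose_proj proj_idempotent[OF eigenvalues_r]]
    symmetric_idempotent_quadratic_form[OF transpose_proj proj_idempotent[OF eigenvalues_s]]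
  have "0 \<le> v \<bullet> (bose_mesner E x y z *v v)" for v
    unfolding decomp matrix_vector_mult_add_rdistrib inner_add_right
      scaleR_matrix_vector_assoc[symmetric] inner_scaleR_right J P
    using assms by simp
  then show ?thesis by (simp add: psd_def symmetric_matrix_def transpose_bose_mesner)
qed

subsection \<open>Integrality of the eigenvalues\<close>

text \<open>The multiplicity \<open>f\<close> of \<open>r\<close> is a natural number. Its trace
  formula rearranges to (n - 1 - 2f)(r - s) = (n - 1)(l - \<mu>) + 2\<kappa>. Either the first
  factor vanishes, so that the multiplicities agree, or r - s is rational.\<close>

lemma conference_or_integral:
  "(int n - 1) * (int \<mu> - int l) = 2 * int \<kappa> \<or> (\<exists>q::int. r - s = of_int q)"
proof -
  obtain f where f: "trace (proj r s) = real f"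
    using trace_symmetric_idempotent_Nats[OF transpose_proj proj_idempotent[OF eigenvalues_r]]
    by (auto elim: Nats_cases)
  define d where "d = r - s"
  have n: "real n > 0" using degree_less by simp
  have d: "d > 0" using s_less_r by (simp add: d_def)
  have s: "2 * s = (real l - real \<mu>) - d" using r_plus_s by (simp add: d_def)
  have "real f * d = real n * (- s / d + - ((real \<kappa> - s) / real n) / d) * d"
    using f unfolding proj_def trace_bose_mesner d_def[symmetric] by simp
  also have "\<dots> = real n * (- s - (real \<kappa> - s) / real n)"
  proof -
    have "x * (- s / d + - q / d) * d = x * (- s - q)" for x q
      using d by (simp add: field_simps)
    then show ?thesis .
  qed
  also have "\<dots> = - (real n - 1) * s - real \<kappa>"
    using n by (simp add: field_simps)
  finally have "real f * d = - (real n - 1) * s - real \<kappa>" .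
  then have "2 * real f * d = - (real n - 1) * (2 * s) - 2 * real \<kappa>" by (simp add: algebra_simps)
  then have eq: "(real n - 1 - 2 * real f) * d = (real n - 1) * (real l - real \<mu>) + 2 * real \<kappa>"
    unfolding s by (simp add: algebra_simps)
  define a b D :: int where "a = int n - 1 - 2 * int f"
    and "b = (int n - 1) * (int l - int \<mu>) + 2 * int \<kappa>"
    and "D = (int l - int \<mu>)\<^sup>2 + 4 * (int \<kappa> - int \<mu>)"
  have ab: "of_int a * d = of_int b" using eq by (simp add: a_def b_def)
  have "d\<^sup>2 = (r + s)\<^sup>2 - 4 * (r * s)" by (simp add: d_def power2_eq_square algebra_simps)
  then have D: "d\<^sup>2 = of_int D" by (simp add: r_plus_s r_times_s D_def)
  show ?thesis
  proof (cases "a = 0")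
    case True
    then have "b = 0" using ab by simp
    then show ?thesis by (simp add: b_def algebra_simps)
  next
    case False
    \<comment> \<open>A rational square root of the integer \<open>D\<close> is an integer, here by
      divisibility of squares.\<close>
    have "(of_int (a\<^sup>2 * D) :: real) = of_int (b\<^sup>2)"
      by (simp add: power_mult_distrib flip: ab D)
    then have "a\<^sup>2 * D = b\<^sup>2" by (simp only: of_int_eq_iff)
    then have "a dvd b" by (metis dvd_triv_left pow_divides_pow_iff zero_less_numeral)
    then obtain q where "b = a * q" by blast
    then have "d = of_int q" using ab False by simp
    then show ?thesis unfolding d_def by blast
  qed
qed

text \<open>The graph is 2-regular without triangles (\<open>l = 0\<close>) and without 4-cycles
  (\<open>\<mu> = 1\<close>). From \<open>a\<close> with neighbors \<open>b\<close> and
  \<open>c\<close>, the second neighbors \<open>d\<close> of \<open>b\<close> and \<open>e\<close>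
  of \<open>c\<close> exhaust the five vertices.\<close>

lemma pentagon_parameters_imp_pentagon:
  assumes "n = 5" "\<kappa> = 2" "l = 0" "\<mu> = 1"
  shows "is_pentagon E"
proof -
  have two: "\<exists>c. c \<noteq> b \<and> {x. E a x} = {b, c}" if "E a b" for a b
  proof -
    obtain x y where "{c. E a c} = {x, y}" "x \<noteq> y"
      using card_nbrs[of a] assms(2) by (auto simp: card_2_iff)
    then show ?thesis using that by (auto simp: set_eq_iff)
  qed
  have tri: False if "E a b" "E b c" "E a c" for a b c
  proof -
    have "common_neighbors E a b = {}" using card_common_adj[of a b] assms(3) that by simp
    then show False using that by (auto simp: common_neighbors_def)
  qed
  have uniq: "x = y" if "a \<noteq> b" "\<not> E a b" "E a x" "E b x" "E a y" "E b y" for a b x y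
  proof -
    have "card (common_neighbors E a b) = 1" using card_common_nonadj[of a b] assms(4) that by simp
    then obtain w where "common_neighbors E a b = {w}" by (auto simp: card_1_singleton_iff)
    moreover have "x \<in> common_neighbors E a b" "y \<in> common_neighbors E a b"
      using that by (auto simp: common_neighbors_def)
    ultimately show ?thesis by simp
  qed
  obtain a b where ab: "E a b" using ex_adj by blast
  obtain c where c: "c \<noteq> b" "{x. E a x} = {b, c}" using two[OF ab] by blast
  have ac: "E a c" using c by blast
  have nbc: "\<not> E b c" using tri ab ac by blast
  have ba: "E b a" and ca: "E c a" using ab ac sym by blast+
  obtain d where d: "d \<noteq> a" "{x. E b x} = {a, d}" using two[OF ba] by blast
  obtain e where e: "e \<noteq> a" "{x. E c x} = {a, e}" using two[OF ca] by blast
  have bd: "E b d" and ce: "E c e" using d e by blast+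
  \<comment> \<open>Otherwise \<open>b\<close> and \<open>c\<close> would have a second common
    neighbor besides \<open>a\<close>.\<close>
  have "d \<noteq> e" using uniq[OF _ nbc ba ca bd] c(1) ce d(1) by blast
  moreover have "d \<noteq> c" using bd nbc by blast
  moreover have "e \<noteq> b" using ce nbc sym by blast
  moreover have "d \<noteq> b" "e \<noteq> c" "b \<noteq> a" "c \<noteq> a" using bd ce ab ac by auto
  ultimately have dist: "distinct [a, b, d, e, c]" using c(1) d(1) e(1) by auto
  have "set [a, b, d, e, c] = UNIV"
    using card_UNIV assms(1) distinct_card[OF dist] by (intro card_subset_eq) auto
  then have U: "UNIV = {a, b, c, d, e}" by auto
  have "\<not> E a d" "\<not> E a e" using c(2) dist by (auto simp: set_eq_iff)
  then have nda: "\<not> E d a" "\<not> E e a" using sym by blast+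
  have "\<not> E b e" "\<not> E c d" using d(2) e(2) dist by (auto simp: set_eq_iff)
  then have ndc: "\<not> E e b" "\<not> E d c" using sym by blast+
  have db: "E d b" using bd sym by blast
  obtain x where x: "x \<noteq> b" "{y. E d y} = {b, x}" using two[OF db] by blast
  then have dx: "E d x" by blast
  have "x \<in> {a, b, c, d, e}" using U by blast
  \<comment> \<open>All other vertices are excluded as the second neighbor of \<open>d\<close>,
    which closes the cycle a, b, d, e, c.\<close>
  then have "x = e" using x(1) nda(1) ndc(2) dx by auto
  then have de: "E d e" using dx by simp
  have edges: "E a b" "E a c" "E b d" "E d e" "E c e" and
    nonedges: "\<not> E b c" "\<not> E d a" "\<not> E e a" "\<not> E e b" "\<not> E d c"
    by (fact ab ac bd de ce nbc nda ndc)+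
  have nonedges': "\<not> E c b" "\<not> E a d" "\<not> E a e" "\<not> E b e" "\<not> E c d"
    using nonedges sym by blast+
  have five: "{0..<5} = {0, 1, 2, 3, 4 :: nat}" by auto
  let ?f = "\<lambda>i. [a, b, d, e, c] ! i"
  have "bij_betw ?f {0..<5} UNIV"
  proof (rule bij_betw_imageI)
    show "inj_on ?f {0..<5}" using dist by (simp add: inj_on_nth)
    show "?f ` {0..<5} = UNIV" unfolding five U by auto
  qed
  moreover have "\<forall>i\<in>{0..<5}. \<forall>j\<in>{0..<5}.
      E (?f i) (?f j) \<longleftrightarrow> j = (i + 1) mod 5 \<or> i = (j + 1) mod 5"
    unfolding five by (simp add: edges nonedges edges[THEN sym[THEN iffD1]] nonedges')
  ultimately show ?thesis unfolding is_pentagon_def by (intro exI[of _ ?f] conjI)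
qed

lemma eigenvalue_bounds:
  assumes "\<not> is_pentagon E"
  shows "s \<le> - 2 \<or> \<kappa> = l + 1" and "1 \<le> r \<or> \<kappa> = \<mu>"
proof -
  have "(s \<le> - 2 \<or> \<kappa> = l + 1) \<and> (1 \<le> r \<or> \<kappa> = \<mu>)"
    using conference_or_integral
  proof
    \<comment> \<open>Since 0 < \<kappa> < n - 1, the factor \<mu> - l lies strictly between 0 and
      2. Hence \<mu> - l = 1 and n = 2\<kappa> + 1, and the degree equation gives \<kappa> = 2\<mu>.
      The value \<mu> = 1 is the pentagon.\<close>
    assume conf: "(int n - 1) * (int \<mu> - int l) = 2 * int \<kappa>"
    have n1: "int n - 1 > int \<kappa>" "int \<kappa> > 0" using degree_less degree_pos by auto
    have "int \<mu> - int l > 0"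
    proof (rule ccontr)
      assume "\<not> int \<mu> - int l > 0"
      then have "(int n - 1) * (int \<mu> - int l) \<le> 0" using n1 by (intro mult_nonneg_nonpos) auto
      then show False using n1 unfolding conf by auto
    qed
    moreover have "int \<mu> - int l < 2"
    proof (rule ccontr)
      assume "\<not> int \<mu> - int l < 2"
      then have "(int n - 1) * 2 \<le> (int n - 1) * (int \<mu> - int l)"
        using n1 by (intro mult_left_mono) auto
      then show False using n1 unfolding conf by auto
    qed
    ultimately have mu: "int \<mu> - int l = 1" by simp
    with conf have n: "int n = 2 * int \<kappa> + 1" by simp
    have rn: "real n = 2 * real \<kappa> + 1" and rl: "real l - real \<mu> = - 1"
      using mu n by linarith+
    have "real \<kappa> * real \<kappa> = real \<kappa> * (2 * real \<mu>)"
      using degree_equation unfolding rn rl by (simp add: algebra_simps)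
    then have k: "real \<kappa> = 2 * real \<mu>" using degree_pos by simp
    have "2 \<le> \<mu>"
    proof (rule ccontr)
      assume "\<not> 2 \<le> \<mu>"
      then have "\<mu> = 1" using k degree_pos by (cases "\<mu> = 0") auto
      then have "n = 5 \<and> \<kappa> = 2 \<and> l = 0 \<and> \<mu> = 1" using k n mu by auto
      then show False using pentagon_parameters_imp_pentagon assms by blast
    qed
    \<comment> \<open>Both products equal 2 - \<mu>.\<close>
    then have "(- 2 - r) * (- 2 - s) \<le> 0" "(1 - r) * (1 - s) \<le> 0"
      unfolding eigenvalues_shift rl k by simp_all
    then show ?thesis using r_nonneg s_le by (auto simp: mult_le_0_iff)
  next
    assume "\<exists>q::int. r - s = of_int q"
    then obtain q :: int where q: "r - s = of_int q" by blast
    define e where "e = int l - int \<mu>"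
    have rs: "r + s = of_int e" using r_plus_s by (simp add: e_def)
    have "(r - s)\<^sup>2 = (r + s)\<^sup>2 - 4 * (r * s)" by (simp add: power2_eq_square algebra_simps)
    then have "(of_int (q\<^sup>2) :: real) = of_int (e\<^sup>2 + 4 * (int \<kappa> - int \<mu>))"
      unfolding q rs r_times_s by simp
    then have sq: "q\<^sup>2 = e\<^sup>2 + 4 * (int \<kappa> - int \<mu>)" by (simp only: of_int_eq_iff)
    \<comment> \<open>This makes r = (e + q) / 2 and s = (e - q) / 2 integers, so the strict bounds
      s < -1 and r > 0 improve to s <= -2 and r >= 1.\<close>
    have parity: "even (q + e)"
    proof -
      have "even (q\<^sup>2) = even (e\<^sup>2)" unfolding sq by simp
      then show ?thesis by simp
    qed
    have "s \<le> - 2" if "\<kappa> \<noteq> l + 1"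
    proof (rule ccontr)
      assume "\<not> s \<le> - 2"
      then have "of_int e + 2 < (of_int q :: real)" "(of_int q :: real) < of_int e + 4"
        using s_less[OF that] q rs by linarith+
      then have "q = e + 3" by linarith
      then show False using parity by simp
    qed
    moreover have "1 \<le> r" if "\<kappa> \<noteq> \<mu>"
    proof (rule ccontr)
      assume "\<not> 1 \<le> r"
      then have "- of_int e < (of_int q :: real)" "(of_int q :: real) < 2 - of_int e"
        using r_pos[OF that] q rs by linarith+
      then have "q = 1 - e" by linarith
      then show False using parity by simp
    qed
    ultimately show ?thesis by blast
  qed
  then show "s \<le> - 2 \<or> \<kappa> = l + 1" "1 \<le> r \<or> \<kappa> = \<mu>" by blast+
qed


subsection \<open>Averaging a feasible matrix over edges and non-edges\<close>

lemma trace_mult_bose_mesner: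
  "trace (Y ** bose_mesner E x y z) = x * trace Y
     + y * (\<Sum>a\<in>UNIV. \<Sum>b\<in>UNIV. Y $ a $ b * of_bool (E a b)) + z * (\<Sum>a\<in>UNIV. \<Sum>b\<in>UNIV. Y $ a $ b)"
proof -
  have delta: "(\<Sum>b\<in>UNIV. Y $ a $ b * of_bool (b = a)) = Y $ a $ a" for a
    by (simp add: of_bool_def if_distrib[of "\<lambda>x. _ * x"] cong: if_cong)
  have "trace (Y ** bose_mesner E x y z) = (\<Sum>a\<in>UNIV. \<Sum>b\<in>UNIV. x * (Y $ a $ b * of_bool (b = a))
      + y * (Y $ a $ b * of_bool (E a b)) + z * Y $ a $ b)"
    by (simp add: trace_def matrix_matrix_mult_def sym algebra_simps)
  then show ?thesis
    by (simp add: sum.distrib delta trace_def flip: sum_distrib_left)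
qed

text \<open>A trace against x I + y A + z J sees only the trace, the sum over the edges and the
  total sum of the entries. Averaging over edges and over non-edges keeps all three.\<close>

lemma average_nonneg_entries:
  fixes Y :: "real^'v^'v"
  assumes diag: "\<And>a. Y $ a $ a = 1" and nonneg: "\<And>a b. 0 \<le> Y $ a $ b"
  obtains y1 y2 where "0 \<le> y1" "0 \<le> y2"
    and "\<And>x y z. trace (Y ** bose_mesner E x y z) =
      trace (bose_mesner E (1 - y2) (y1 - y2) y2 ** bose_mesner E x y z)"
proof -
  \<comment> \<open>The number of ordered pairs of distinct nonadjacent vertices; n \<kappa> is that
    of adjacent ones.\<close>
  define N where "N = real n * (real n - 1 - real \<kappa>)"
  define T1 where "T1 = (\<Sum>a\<in>UNIV. \<Sum>b\<in>UNIV. Y $ a $ b * of_bool (E a b))"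
  define T2 where "T2 = (\<Sum>a\<in>UNIV. \<Sum>b\<in>UNIV. Y $ a $ b * of_bool (a \<noteq> b \<and> \<not> E a b))"
  have n: "real n > 0" and k: "real \<kappa> > 0" using degree_less degree_pos by auto
  have N: "N > 0" unfolding N_def using degree_less by (intro mult_pos_pos) auto
  define y1 y2 where "y1 = T1 / (real n * real \<kappa>)" and "y2 = T2 / N"
  have T1: "T1 = real n * real \<kappa> * y1" and T2: "T2 = N * y2"
    using n k N by (simp_all add: y1_def y2_def)
  have trY: "trace Y = real n" by (simp add: trace_def diag card_UNIV)
  have "(\<Sum>b\<in>UNIV. Y $ a $ b) = 1 + (\<Sum>b\<in>UNIV. Y $ a $ b * of_bool (E a b))
      + (\<Sum>b\<in>UNIV. Y $ a $ b * of_bool (a \<noteq> b \<and> \<not> E a b))" for a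
  proof -
    have "(\<Sum>b\<in>UNIV. Y $ a $ b) = (\<Sum>b\<in>UNIV. of_bool (a = b) + Y $ a $ b * of_bool (E a b)
      + Y $ a $ b * of_bool (a \<noteq> b \<and> \<not> E a b))"
      by (intro sum.cong) (auto simp: diag)
    then show ?thesis by (simp add: sum.distrib of_bool_def)
  qed
  then have total: "(\<Sum>a\<in>UNIV. \<Sum>b\<in>UNIV. Y $ a $ b) = real n + T1 + T2"
    by (simp add: sum.distrib T1_def T2_def card_UNIV)
  show ?thesis
  proof
    show "0 \<le> y1" "0 \<le> y2"
      unfolding y1_def y2_def T1_def T2_def using nonneg N
      by (auto intro!: divide_nonneg_nonneg sum_nonneg)
    let ?B = "bose_mesner E (1 - y2) (y1 - y2) y2"
    fix x y z
    have trB: "trace ?B = real n" by (simp add: trace_bose_mesner)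
    have "(\<Sum>a\<in>UNIV. \<Sum>b\<in>UNIV. ?B $ a $ b * of_bool (E a b))
        = (\<Sum>a\<in>UNIV. \<Sum>b\<in>UNIV. y1 * of_bool (E a b))"
      by (intro sum.cong) auto
    then have 1: "(\<Sum>a\<in>UNIV. \<Sum>b\<in>UNIV. ?B $ a $ b * of_bool (E a b)) = T1"
      by (simp add: T1 sum_adj card_UNIV flip: sum_distrib_left)
    have row: "(\<Sum>b\<in>UNIV. ?B $ a $ b) = (1 - y2) + (y1 - y2) * real \<kappa> + real n * y2" for a
      unfolding bose_mesner_nth sum.distrib sum_distrib_left[symmetric] sum_adj
      by (simp add: of_bool_def card_UNIV)
    have 2: "(\<Sum>a\<in>UNIV. \<Sum>b\<in>UNIV. ?B $ a $ b) = real n + T1 + T2"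
      unfolding row by (simp add: T1 T2 N_def card_UNIV algebra_simps)
    show "trace (Y ** bose_mesner E x y z) = trace (?B ** bose_mesner E x y z)"
      unfolding trace_mult_bose_mesner 1 2 trB trY T1_def[symmetric] total ..
  qed
qed

section \<open>The averaged matrix in the two programs\<close>

lemma trace_scaleR_diff_mult:
  fixes Y M C :: "real^'v^'v"
  shows "trace ((c *\<^sub>R Y - M) ** C) = c * trace (Y ** C) - trace (M ** C)"
  by (simp add: trace_def matrix_matrix_mult_def sum_subtractf sum_distrib_left left_diff_distrib
      mult.assoc)

lemma all_ones_eq_bose_mesner: "all_ones_matrix = bose_mesner E 0 0 1"
  and adj_eq_bose_mesner: "adj_matrix E = bose_mesner E 0 1 0"
  by (simp_all add: vec_eq_iff all_ones_matrix_def adj_matrix_def of_bool_def)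

lemma scaleR_bose_mesner_diff_all_ones:
  "c *\<^sub>R bose_mesner E x y z - all_ones_matrix = bose_mesner E (c * x) (c * y) (c * z - 1)"
  by (simp add: vec_eq_iff all_ones_matrix_def algebra_simps)

text \<open>With \<open>u = 1 - y1\<close> and \<open>v = 1 - y2\<close> the eigenvalue constraints read \<open>-s u \<ge> (-s - 1) v\<close> and
  \<open>(1 + r) v \<ge> r u\<close>, while the triangle constraints are \<open>2 u \<ge> v\<close> and \<open>2 v \<ge> u\<close>; the former
  imply the latter once \<open>-s \<ge> 2\<close> and \<open>1 + r \<ge> 2\<close>.\<close>

lemma triangle_constraints_bose_mesner:
  assumes "\<not> is_pentagon E"
    and cr: "0 \<le> (1 - y2) + (y1 - y2) * r" and cs: "0 \<le> (1 - y2) + (y1 - y2) * s"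
  shows "triangle_constraints (bose_mesner E (1 - y2) (y1 - y2) y2)"
proof -
  define u v t where "u = 1 - y1" and "v = 1 - y2" and "t = - s"
  have y: "y1 = 1 - u" "y2 = 1 - v" by (simp_all add: u_def v_def)
  have t: "1 \<le> t" using s_le by (simp add: t_def)
  have s: "s = - t" by (simp add: t_def)
  have cr': "r * u \<le> (1 + r) * v" using cr unfolding y by (simp add: algebra_simps)
  have cs': "(t - 1) * v \<le> t * u" using cs unfolding y s by (simp add: algebra_simps)
  \<comment> \<open>Eliminating \<open>u\<close>: add \<open>t\<close> times the first constraint
    and \<open>r\<close> times the second.\<close>
  have "0 \<le> (t + r) * v"
  proof -
    have "t * (r * u) \<le> t * ((1 + r) * v)" using cr' t by (intro mult_left_mono) auto
    moreover have "r * ((t - 1) * v) \<le> r * (t * u)" using cs' r_nonneg by (intro mult_left_mono) auto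
    ultimately show ?thesis by (simp add: algebra_simps)
  qed
  then have v: "0 \<le> v" using t r_nonneg by (simp add: zero_le_mult_iff)
  have "0 \<le> (t - 1) * v" using t v by simp
  then have "0 \<le> t * u" using cs' by (rule order_trans)
  then have u: "0 \<le> u" using t by (simp add: zero_le_mult_iff)
  have vu: "v \<le> 2 * u" if "2 \<le> t"
  proof -
    have "t * v \<le> 2 * ((t - 1) * v)"
      unfolding mult.assoc[symmetric] using that v by (intro mult_right_mono) auto
    also have "\<dots> \<le> t * (2 * u)" using cs' by simp
    finally show ?thesis using that by simp
  qed
  have uv: "u \<le> 2 * v" if "1 \<le> r"
  proof -
    have "r * u \<le> (1 + r) * v" by (fact cr')
    also have "\<dots> \<le> (2 * r) * v" using that v by (intro mult_right_mono) auto
    finally show ?thesis using that by simp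
  qed
  \<comment> \<open>For exactly two edges meeting at \<open>a\<close> the triangle inequality reads
    \<open>v \<le> 2 * u\<close>, and for a single edge opposite to \<open>a\<close> it reads
    \<open>u \<le> 2 * v\<close>. If the eigenvalue bound fails, the twin lemmas show that no such
    triple exists. All other patterns reduce to \<open>u\<close> or \<open>v\<close> being
    nonnegative.\<close>
  have vu': "v \<le> 2 * u" if "E a b" "E a c" "\<not> E b c" "b \<noteq> c" for a b c
    using eigenvalue_bounds(1)[OF assms(1)] vu adj_twins[of a b c] that by (auto simp: s)
  have uv': "u \<le> 2 * v" if "a \<noteq> b" "\<not> E a b" "\<not> E a c" "E b c" for a b c
    using eigenvalue_bounds(2)[OF assms(1)] uv nonadj_twins[of a b c] that by auto
  show ?thesis
    unfolding triangle_constraints_def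
  proof (intro allI impI)
    fix a b c :: 'v
    assume ne: "a \<noteq> b \<and> a \<noteq> c \<and> b \<noteq> c"
    let ?y = "\<lambda>a b. 1 - (if E a b then u else v)"
    have entry: "bose_mesner E (1 - y2) (y1 - y2) y2 $ p $ q = ?y p q" if "p \<noteq> q" for p q
      using that by (simp add: u_def v_def)
    have "?y a b + ?y a c \<le> 1 + ?y b c"
      using u v vu'[of a b c] uv'[of a b c] ne by auto
    then show "bose_mesner E (1 - y2) (y1 - y2) y2 $ a $ b + bose_mesner E (1 - y2) (y1 - y2) y2 $ a $ c
        \<le> 1 + bose_mesner E (1 - y2) (y1 - y2) y2 $ b $ c"
      using entry[of a b] entry[of a c] entry[of b c] ne by metis
  qed
qed

text \<open>The objective depends on \<open>Y\<close> only through its trace against A, which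
  averaging preserves.\<close>

lemma GPPm_objective_eq:
  "GPPm_objective E Y = 1 / 2 * (trace (adj_matrix E ** all_ones_matrix) - trace (Y ** bose_mesner E 0 1 0))"
proof -
  have "trace (adj_matrix E ** (all_ones_matrix - Y)) = trace ((all_ones_matrix - Y) ** adj_matrix E)"
    by (rule trace_mul_sym)
  also have "\<dots> = trace (all_ones_matrix ** adj_matrix E) - trace (Y ** adj_matrix E)"
    using trace_scaleR_diff_mult[of 1 all_ones_matrix Y "adj_matrix E"] by simp
  also have "trace (all_ones_matrix ** adj_matrix E) = trace (adj_matrix E ** all_ones_matrix)"
    by (rule trace_mul_sym)
  finally show ?thesis by (simp add: GPPm_objective_def adj_eq_bose_mesner)
qed

lemma GPPm_feasible_average:
  assumes "\<not> is_pentagon E" "k > 0" "Y \<in> GPPm_feasible k m"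
  shows "\<exists>Z \<in> GPPm_triangle_feasible k m. GPPm_objective E Z = GPPm_objective E Y"
proof -
  have diag: "Y $ a $ a = 1" for a
    using assms(3) by (simp add: GPPm_feasible_def diag_vec_def all_ones_vec_def vec_eq_iff)
  have nonneg: "0 \<le> Y $ a $ b" for a b using assms(3) by (simp add: GPPm_feasible_def)
  have psd: "psd (real k *\<^sub>R Y - all_ones_matrix)" using assms(3) by (simp add: GPPm_feasible_def)
  have k: "real k > 0" using assms(2) by simp
  have n: "real n > 0" using degree_less by simp
  from average_nonneg_entries[OF diag nonneg] obtain y1 y2 where y: "0 \<le> y1" "0 \<le> y2"
    and tr: "\<And>x y z. trace (Y ** bose_mesner E x y z) =
      trace (bose_mesner E (1 - y2) (y1 - y2) y2 ** bose_mesner E x y z)"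
    by blast
  define Z where "Z = bose_mesner E (1 - y2) (y1 - y2) y2"
  note tr = tr[folded Z_def]
  have shift: "real k *\<^sub>R Z - all_ones_matrix
      = bose_mesner E (real k * (1 - y2)) (real k * (y1 - y2)) (real k * y2 - 1)"
    unfolding Z_def by (rule scaleR_bose_mesner_diff_all_ones)
  have trM: "trace ((real k *\<^sub>R Y - all_ones_matrix) ** bose_mesner E x y z) =
      trace ((real k *\<^sub>R Z - all_ones_matrix) ** bose_mesner E x y z)" for x y z
    by (simp add: trace_scaleR_diff_mult tr)
  have trP: "trace ((real k *\<^sub>R Y - all_ones_matrix) ** proj \<theta> \<tau>) =
      trace (bose_mesner E (real k * (1 - y2)) (real k * (y1 - y2)) (real k * y2 - 1) ** proj \<theta> \<tau>)" for \<theta> \<tau>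
    unfolding proj_def trM shift ..
  \<comment> \<open>The eigenvalues of kZ - J on the complement of the all-ones vector are those of
    kZ, so the positive factor \<open>k\<close> can be cancelled to obtain the constraints on y1 and
    y2.\<close>
  have "0 \<le> real k * (1 - y2) + real k * (y1 - y2) * r"
    by (rule psd_trace_proj_imp_nonneg[OF psd eigenvalues_r trP])
  then have "0 \<le> real k * ((1 - y2) + (y1 - y2) * r)" by (simp add: algebra_simps)
  then have cr: "0 \<le> (1 - y2) + (y1 - y2) * r" using k by (simp add: zero_le_mult_iff)
  have "0 \<le> real k * (1 - y2) + real k * (y1 - y2) * s"
    by (rule psd_trace_proj_imp_nonneg[OF psd eigenvalues_s trP])
  then have "0 \<le> real k * ((1 - y2) + (y1 - y2) * s)" by (simp add: algebra_simps)
  then have cs: "0 \<le> (1 - y2) + (y1 - y2) * s" using k by (simp add: zero_le_mult_iff)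
  \<comment> \<open>The projection onto the all-ones vector supplies the third eigenvalue of kZ - J,
    where J does contribute.\<close>
  let ?J = "bose_mesner E 0 0 (1 / real n)"
  have "?J ** ?J = ?J" using n by (simp add: bose_mesner_mult)
  then have "0 \<le> trace ((real k *\<^sub>R Y - all_ones_matrix) ** ?J)"
    by (intro trace_psd_mult_idempotent_nonneg transpose_bose_mesner psd)
  also have "\<dots> = real k * (1 - y2) + real k * (y1 - y2) * real \<kappa> + (real k * y2 - 1) * real n"
    unfolding trM shift bose_mesner_mult trace_bose_mesner using n by (simp add: field_simps)
  finally have "psd (real k *\<^sub>R Z - all_ones_matrix)"
    unfolding shift using cr cs k
    by (intro psd_bose_mesner)
      (simp_all add: mult.assoc flip: distrib_left)
  moreover have "trace (all_ones_matrix ** Z) = trace (all_ones_matrix ** Y)"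
    using tr[of 0 0 1] unfolding all_ones_eq_bose_mesner by (metis trace_mul_sym)
  moreover have "0 \<le> Z $ a $ b" for a b using y by (auto simp: Z_def)
  moreover have "symmetric_matrix Z" by (simp add: symmetric_matrix_def Z_def transpose_bose_mesner)
  moreover have "diag_vec Z = all_ones_vec" by (simp add: vec_eq_iff diag_vec_def all_ones_vec_def Z_def)
  ultimately have "Z \<in> GPPm_feasible k m" using assms(3) by (simp add: GPPm_feasible_def)
  then have "Z \<in> GPPm_triangle_feasible k m"
    using triangle_constraints_bose_mesner[OF assms(1) cr cs]
    by (simp add: GPPm_triangle_feasible_def Z_def)
  moreover have "GPPm_objective E Z = GPPm_objective E Y"
    by (simp add: GPPm_objective_eq tr)
  ultimately show ?thesis by blast
qed

end

theorem mainTheorem3: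
  fixes E :: "'v::finite \<Rightarrow> 'v \<Rightarrow> bool"
    and n \<kappa> l \<mu> k :: nat
    and m :: "nat \<Rightarrow> nat"
  assumes "strongly_regular E n \<kappa> l \<mu>"
    and "\<not> is_pentagon E"
    and "k > 0"
    and "\<And>i. i \<in> {1..k} \<Longrightarrow> m i > 0"
    and "(\<Sum>i=1..k. m i) = n"
  shows "GPPm_triangle_value E k m = GPPm_value E k m"
proof -
  interpret srg E n \<kappa> l \<mu> using assms(1) by unfold_locales
  show ?thesis
  proof (rule antisym)
    show "GPPm_value E k m \<le> GPPm_triangle_value E k m"
      unfolding GPPm_value_def GPPm_triangle_value_def
      by (rule INF_superset_mono) (auto simp: GPPm_triangle_feasible_def)
    show "GPPm_triangle_value E k m \<le> GPPm_value E k m"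
      unfolding GPPm_value_def GPPm_triangle_value_def
    \<comment> \<open>Each feasible matrix is matched by one of equal objective value, so the infima
      are compared without assuming that they are attained.\<close>
    proof (rule INF_mono)
      fix Y :: "real^'v^'v"
      assume "Y \<in> GPPm_feasible k m"
      from GPPm_feasible_average[OF assms(2,3) this]
      show "\<exists>Z\<in>GPPm_triangle_feasible k m. ereal (GPPm_objective E Z) \<le> ereal (GPPm_objective E Y)"
        by (metis order_refl)
    qed
  qed
qed

end
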